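(* Let $(X,\mathbb{F})$ be a non-autonomous system. (1) If $(X,\mathbb{F})$ is pointwise asymptotically commutative, then the set $P(X,\mathbb{F})$ of proximal pairs is invariant, and the set $L(X,\mathbb{F})$ of syndetically proximal pairs is invariant. (2) If $(X,\mathbb{F})$ is asymptotically commutative, then the set $Q(X,\mathbb{F})$ of regionally proximal pairs is invariant, and the set $M(X,\mathbb{F})$ of regionally syndetically proximal pairs is invariant.
   Context: A non-autonomous system $(X,\mathbb{F})$ consists of a compact metric space $(X,d_X)$ and a sequence $\mathbb{F}=(f_n)_{n\ge 1}$ of surjective continuous self-maps of $X$. For $k\in\mathbb{N}$, $\omega_k=f_k\circ\cdots\circ f_1$. A set $S=\{s_n:n\in\mathbb{N}\}\subseteq\mathbb{N}$ (with $s_1<s_2<\cdots$) is syndetic if there is $M\in\mathbb{N}$ with $|s_{n+1}-s_n|\le M$ for all $n$. For $x,y\in X$, the pair $(x,y)$ is: - proximal if $\liminf_{n} d_X(\omega_n(x),\omega_n(y))=0$; - syndetically proximal if for every $\epsilon>0$ the set $\{n\in\mathbb{N}: d_X(\omega_n(x),\omega_n(y))<\epsilon\}$ is syndetic; - regionally proximal if for every $\epsilon>0$ and all neighborhoods $U$ of $x$ and $V$ of $y$ there are $z_1\in U$, $z_2\in V$ such that $\{n\in\mathbb{N}: d_X(\omega_n(z_1),\omega_n(z_2))<\epsilon\}$ is non-empty; - regionally syndetically proximal if for every $\epsilon>0$ and all neighborhoods $U$ of $x$ and $V$ of $y$ there are $z_1\in U$, $z_2\in V$ such that $\{n\in\mathbb{N}: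 d_X(\omega_n(z_1),\omega_n(z_2))<\epsilon\}$ is syndetic. $P(X,\mathbb{F})$, $L(X,\mathbb{F})$, $Q(X,\mathbb{F})$, $M(X,\mathbb{F})\subseteq X\times X$ denote the corresponding sets of pairs. The orbit of a pair is $\mathcal{O}_{\mathbb{F}}((x,y))=\{(\omega_n(x),\omega_n(y)):n\in\mathbb{N}\}$; if all $f_n$ are homeomorphisms the full orbit is used, i.e. $n$ ranges over $\mathbb{Z}$ with $\omega_{-n}=(\omega_n)^{-1}$ and $\omega_0=\mathrm{id}$. A set $Y\subseteq X\times X$ is invariant if $\mathcal{O}_{\mathbb{F}}((x,y))\subseteq Y$ for every $(x,y)\in Y$. $D_{C(X)}(f,g)=\sup_{x\in X}d_X(f(x),g(x))$ for continuous self-maps $f,g$ of $X$. $(X,\mathbb{F})$ is pointwise asymptotically commutative if $\lim_{n\to\infty}d_X(\omega_n\circ\omega_r(x),\omega_r\circ\omega_n(x))=0$ for every $x\in X$ and $r\in\mathbb{N}$; it is asymptotically commutative if $\lim_{n\to\infty}D_{C(X)}(\omega_n\circ\omega_r,\omega_r\circ\omega_n)=0$ for every $r\in\mathbb{N}$. *)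

theory Defs
  imports "HOL-Analysis.Analysis"
begin

text \<open>
  A system is a sequence \<open>F 1, F 2, \<dots>\<close> of self-maps of a compact metric space, which is
  the whole type \<open>'a\<close>. The natural numbers start at \<open>1\<close>; the value \<open>F 0\<close> is never used.
\<close>

locale nonautonomous_system =
  fixes F :: "nat \<Rightarrow> 'a::metric_space \<Rightarrow> 'a"
  assumes compact_space: "compact (UNIV :: 'a set)"
    and continuous: "n \<ge> 1 \<Longrightarrow> continuous_on UNIV (F n)"
    and surjective: "n \<ge> 1 \<Longrightarrow> surj (F n)"

primrec omega :: "(nat \<Rightarrow> 'a \<Rightarrow> 'a) \<Rightarrow> nat \<Rightarrow> 'a \<Rightarrow> 'a" where
  "omega F 0 = id"
| "omega F (Suc n) = F (Suc n) \<circ> omega F n"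

text \<open>
  The set is infinite, being listed by the strictly increasing sequence \<open>s\<close>; the bound
  concerns only consecutive elements and puts no constraint on the first one.
\<close>

definition syndetic :: "nat set \<Rightarrow> bool" where
  "syndetic S \<longleftrightarrow> (\<exists>s :: nat \<Rightarrow> nat. strict_mono s \<and> S = range s \<and>
     (\<exists>M. \<forall>n. s (Suc n) - s n \<le> M))"

definition close_times ::
  "(nat \<Rightarrow> 'a::metric_space \<Rightarrow> 'a) \<Rightarrow> real \<Rightarrow> 'a \<Rightarrow> 'a \<Rightarrow> nat set" where
  "close_times F \<epsilon> x y = {n. n \<ge> 1 \<and> dist (omega F n x) (omega F n y) < \<epsilon>}"

definition proximal_pairs :: "(nat \<Rightarrow> 'a::metric_space \<Rightarrow> 'a) \<Rightarrow> ('a \<times> 'a) set" where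
  "proximal_pairs F =
     {(x, y). liminf (\<lambda>n. ereal (dist (omega F n x) (omega F n y))) = 0}"

definition syndetically_proximal_pairs ::
  "(nat \<Rightarrow> 'a::metric_space \<Rightarrow> 'a) \<Rightarrow> ('a \<times> 'a) set" where
  "syndetically_proximal_pairs F = {(x, y). \<forall>\<epsilon>>0. syndetic (close_times F \<epsilon> x y)}"

definition regionally_proximal_pairs ::
  "(nat \<Rightarrow> 'a::metric_space \<Rightarrow> 'a) \<Rightarrow> ('a \<times> 'a) set" where
  "regionally_proximal_pairs F =
     {(x, y). \<forall>\<epsilon>>0. \<forall>U V. x \<in> interior U \<longrightarrow> y \<in> interior V \<longrightarrow>
        (\<exists>z1\<in>U. \<exists>z2\<in>V. close_times F \<epsilon> z1 z2 \<noteq> {})}"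

definition regionally_syndetically_proximal_pairs ::
  "(nat \<Rightarrow> 'a::metric_space \<Rightarrow> 'a) \<Rightarrow> ('a \<times> 'a) set" where
  "regionally_syndetically_proximal_pairs F =
     {(x, y). \<forall>\<epsilon>>0. \<forall>U V. x \<in> interior U \<longrightarrow> y \<in> interior V \<longrightarrow>
        (\<exists>z1\<in>U. \<exists>z2\<in>V. syndetic (close_times F \<epsilon> z1 z2))}"

definition all_homeomorphisms :: "(nat \<Rightarrow> 'a::topological_space \<Rightarrow> 'a) \<Rightarrow> bool" where
  "all_homeomorphisms F \<longleftrightarrow> (\<forall>n\<ge>1. \<exists>g. homeomorphism UNIV UNIV (F n) g)"

text \<open>Only meaningful when every \<open>F n\<close> with \<open>n \<ge> 1\<close> is bijective.\<close>

definition omega_int :: "(nat \<Rightarrow> 'a \<Rightarrow> 'a) \<Rightarrow> int \<Rightarrow> 'a \<Rightarrow> 'a" where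
  "omega_int F k = (if k \<ge> 0 then omega F (nat k) else inv (omega F (nat (- k))))"

text \<open>The full orbit if all maps are homeomorphisms, the forward orbit otherwise.\<close>

definition pair_orbit ::
  "(nat \<Rightarrow> 'a::topological_space \<Rightarrow> 'a) \<Rightarrow> 'a \<times> 'a \<Rightarrow> ('a \<times> 'a) set" where
  "pair_orbit F p =
     (if all_homeomorphisms F
      then {(omega_int F k (fst p), omega_int F k (snd p)) | k. True}
      else {(omega F n (fst p), omega F n (snd p)) | n. n \<ge> 1})"

definition invariant_pairs ::
  "(nat \<Rightarrow> 'a::topological_space \<Rightarrow> 'a) \<Rightarrow> ('a \<times> 'a) set \<Rightarrow> bool" where
  "invariant_pairs F Y \<longleftrightarrow> (\<forall>p\<in>Y. pair_orbit F p \<subseteq> Y)"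

text \<open>
  The supremum is taken in the reals; for the maps considered here the set of distances is
  nonempty and bounded because the space is compact.
\<close>

definition dist_sup :: "('a::metric_space \<Rightarrow> 'a) \<Rightarrow> ('a \<Rightarrow> 'a) \<Rightarrow> real" where
  "dist_sup f g = (SUP x. dist (f x) (g x))"

definition pointwise_asymptotically_commutative ::
  "(nat \<Rightarrow> 'a::metric_space \<Rightarrow> 'a) \<Rightarrow> bool" where
  "pointwise_asymptotically_commutative F \<longleftrightarrow>
     (\<forall>x. \<forall>r\<ge>1. (\<lambda>n. dist ((omega F n \<circ> omega F r) x) ((omega F r \<circ> omega F n) x))
        \<longlonglongrightarrow> 0)"

definition asymptotically_commutative ::
  "(nat \<Rightarrow> 'a::metric_space \<Rightarrow> 'a) \<Rightarrow> bool" where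
  "asymptotically_commutative F \<longleftrightarrow>
     (\<forall>r\<ge>1. (\<lambda>n. dist_sup (omega F n \<circ> omega F r) (omega F r \<circ> omega F n))
        \<longlonglongrightarrow> 0)"

end

theory Submission
  imports Defs
begin

text \<open>
  An orbit map \<open>g\<close>, that is \<open>\<omega>\<^sub>r\<close> or its inverse, is uniformly continuous and commutes
  asymptotically with \<open>\<omega>\<^sub>n\<close>: for the inverse \<open>h\<close> of \<open>\<omega>\<^sub>r\<close>, apply \<open>h\<close> to the small
  distance between \<open>\<omega>\<^sub>n (\<omega>\<^sub>r (h x))\<close> and \<open>\<omega>\<^sub>r (\<omega>\<^sub>n (h x))\<close>. Hence if \<open>\<omega>\<^sub>n x\<close> and \<open>\<omega>\<^sub>n y\<close> are
  close at a late time \<open>n\<close>, so are \<open>\<omega>\<^sub>n (g x)\<close> and \<open>\<omega>\<^sub>n (g y)\<close>, and each of the four relations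
  only has to be insensitive to discarding finitely many times. For regional proximality, where
  a single time is given, that time can be made late: sufficient closeness at any time
  \<open>n \<le> N\<close> forces closeness at time \<open>N\<close>.
\<close>

section \<open>Syndetic sets of natural numbers\<close>

text \<open>Windows of fixed length replace the listing \<open>s\<close>, so that enlarging the set
  or dropping an initial segment is easy to handle. The unconstrained first element
  \<open>s 0\<close> is absorbed into the window length; conversely, meeting every window forces
  \<open>S\<close> to be infinite, so its increasing enumeration exists.\<close>

lemma syndetic_iff: "syndetic S \<longleftrightarrow> (\<exists>M. \<forall>n. \<exists>m\<in>S. n \<le> m \<and> m \<le> n + M)"
proof
  assume "syndetic S"
  then obtain s :: "nat \<Rightarrow> nat" and M where s: "strict_mono s" "S = range s"
    and M: "\<And>n. s (Suc n) - s n \<le> M"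
    unfolding syndetic_def by blast
  have "\<exists>m\<in>S. n \<le> m \<and> m \<le> n + (s 0 + M)" for n
  proof -
    define k where "k = (LEAST k. n \<le> s k)"
    have k: "n \<le> s k"
      unfolding k_def by (rule LeastI[of _ n]) (simp add: s(1) strict_mono_imp_increasing)
    \<comment> \<open>For \<open>k = 0\<close> the summand \<open>s 0\<close> suffices; otherwise
      \<open>s (k - 1) < n\<close> by minimality of \<open>k\<close>, and the gap bound
      applies.\<close>
    have "s k \<le> n + (s 0 + M)"
    proof (cases k)
      case (Suc j)
      then have "\<not> n \<le> s j"
        unfolding k_def by (intro not_less_Least) simp
      then show ?thesis using M[of j] Suc by simp
    qed simp
    with k s(2) show ?thesis by blast
  qed
  then show "\<exists>M. \<forall>n. \<exists>m\<in>S. n \<le> m \<and> m \<le> n + M" by blast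
next
  assume "\<exists>M. \<forall>n. \<exists>m\<in>S. n \<le> m \<and> m \<le> n + M"
  then obtain M where M: "\<And>n. \<exists>m\<in>S. n \<le> m \<and> m \<le> n + M" by blast
  then have inf: "infinite S" unfolding infinite_nat_iff_unbounded_le by blast
  \<comment> \<open>The search window starts one past the current element, hence
    \<open>Suc M\<close>.\<close>
  have "enumerate S (Suc n) - enumerate S n \<le> Suc M" for n
  proof -
    obtain m where m: "m \<in> S" "Suc (enumerate S n) \<le> m" "m \<le> Suc (enumerate S n) + M"
      using M by blast
    have "enumerate S (Suc n) \<le> m"
      unfolding enumerate_Suc''[OF inf] using m by (intro Least_le) simp
    with m show ?thesis by simp
  qed
  moreover have "strict_mono (enumerate S)" using inf by (rule strict_mono_enumerate)
  moreover have "S = range (enumerate S)" using inf by (simp add: range_enumerate)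
  ultimately show "syndetic S" unfolding syndetic_def by blast
qed

text \<open>Starting the search in \<open>S\<close> at \<open>n + N\<close> skips the discarded
  times and lengthens each window by \<open>N\<close>.\<close>

lemma syndetic_superset_of_tail:
  assumes "syndetic S" "S \<inter> {N..} \<subseteq> T"
  shows "syndetic T"
proof -
  obtain M where M: "\<And>n. \<exists>m\<in>S. n \<le> m \<and> m \<le> n + M"
    using assms(1) unfolding syndetic_iff by blast
  have "\<exists>m\<in>T. n \<le> m \<and> m \<le> n + (N + M)" for n
  proof -
    obtain m where "m \<in> S" "n + N \<le> m" "m \<le> n + N + M" using M by blast
    then show ?thesis using assms(2) by (intro bexI[of _ m]) auto
  qed
  then show ?thesis unfolding syndetic_iff by blast
qed

section \<open>Lower limits and proximality\<close>

text \<open>Nonnegativity gives one inequality; failure of the other means that \<open>f\<close>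
  eventually stays above a fixed positive real.\<close>

lemma liminf_eq_0_iff:
  fixes f :: "nat \<Rightarrow> real"
  assumes "\<And>n. 0 \<le> f n"
  shows "liminf (\<lambda>n. ereal (f n)) = 0 \<longleftrightarrow> (\<forall>\<epsilon>>0. \<exists>\<^sub>F n in sequentially. f n < \<epsilon>)"
proof -
  have "0 \<le> liminf (\<lambda>n. ereal (f n))"
    by (rule Liminf_bounded) (simp add: assms)
  then have "liminf (\<lambda>n. ereal (f n)) = 0 \<longleftrightarrow> liminf (\<lambda>n. ereal (f n)) \<le> 0"
    by auto
  also have "\<dots> \<longleftrightarrow> (\<forall>\<epsilon>>0. \<exists>\<^sub>F n in sequentially. f n < \<epsilon>)"
  proof
    assume le: "liminf (\<lambda>n. ereal (f n)) \<le> 0"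
    show "\<forall>\<epsilon>>0. \<exists>\<^sub>F n in sequentially. f n < \<epsilon>"
    proof (intro allI impI, rule ccontr)
      fix \<epsilon> :: real
      assume \<epsilon>: "0 < \<epsilon>" and "\<not> (\<exists>\<^sub>F n in sequentially. f n < \<epsilon>)"
      then have "\<forall>\<^sub>F n in sequentially. ereal \<epsilon> \<le> ereal (f n)"
        by (simp add: not_frequently not_less)
      then have "ereal \<epsilon> \<le> liminf (\<lambda>n. ereal (f n))" by (rule Liminf_bounded)
      from this le have "ereal \<epsilon> \<le> 0" by (rule order_trans)
      with \<epsilon> show False by simp
    qed
  next
    assume freq: "\<forall>\<epsilon>>0. \<exists>\<^sub>F n in sequentially. f n < \<epsilon>"
    show "liminf (\<lambda>n. ereal (f n)) \<le> 0"
    proof (rule ccontr)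
      assume "\<not> liminf (\<lambda>n. ereal (f n)) \<le> 0"
      \<comment> \<open>A real threshold is chosen by density, since the lower limit may be
        infinite.\<close>
      then obtain \<epsilon> where \<epsilon>: "0 < ereal \<epsilon>" "ereal \<epsilon> < liminf (\<lambda>n. ereal (f n))"
        using ereal_dense2[of 0 "liminf (\<lambda>n. ereal (f n))"] by (auto simp: not_le)
      from \<epsilon>(2) have "\<forall>\<^sub>F n in sequentially. ereal \<epsilon> < ereal (f n)" by (rule less_LiminfD)
      then have "\<forall>\<^sub>F n in sequentially. \<not> f n < \<epsilon>"
        by (rule eventually_mono) simp
      with freq \<epsilon>(1) show False by (auto simp: frequently_def)
    qed
  qed
  finally show ?thesis .
qed

text \<open>This puts proximality in terms of \<open>close_times\<close>, like the other three
  relations.\<close>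

lemma proximal_pairs_iff:
  "(x, y) \<in> proximal_pairs F \<longleftrightarrow> (\<forall>\<epsilon>>0. \<forall>N. close_times F \<epsilon> x y \<inter> {N..} \<noteq> {})"
proof -
  have "(\<exists>\<^sub>F n in sequentially. dist (omega F n x) (omega F n y) < \<epsilon>) \<longleftrightarrow>
      (\<forall>N. close_times F \<epsilon> x y \<inter> {N..} \<noteq> {})" (is "?freq \<longleftrightarrow> ?late") for \<epsilon>
  proof
    assume freq: ?freq
    show ?late
    proof
      fix N
      \<comment> \<open>\<open>Suc N\<close> makes \<open>n\<close> positive, as
        \<open>close_times\<close> demands.\<close>
      obtain n where "Suc N \<le> n" "dist (omega F n x) (omega F n y) < \<epsilon>"
        using freq unfolding frequently_sequentially by blast
      then have "n \<in> close_times F \<epsilon> x y \<inter> {N..}" by (simp add: close_times_def)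
      then show "close_times F \<epsilon> x y \<inter> {N..} \<noteq> {}" by blast
    qed
  next
    assume ?late
    then show ?freq unfolding frequently_sequentially close_times_def by fastforce
  qed
  then show ?thesis by (simp add: proximal_pairs_def liminf_eq_0_iff)
qed

section \<open>Asymptotic commutation and transfer of close times\<close>

text \<open>
  Taking \<open>A\<close> finite gives pointwise asymptotic commutation, taking \<open>A = UNIV\<close> the uniform one.
\<close>

definition asymptotically_commutes_on ::
  "(nat \<Rightarrow> 'a::metric_space \<Rightarrow> 'a) \<Rightarrow> 'a set \<Rightarrow> ('a \<Rightarrow> 'a) \<Rightarrow> bool" where
  "asymptotically_commutes_on F A g \<longleftrightarrow>
     (\<forall>\<epsilon>>0. \<forall>\<^sub>F n in sequentially. \<forall>x\<in>A. dist (omega F n (g x)) (g (omega F n x)) < \<epsilon>)"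

text \<open>The commutation of \<open>f\<close> is used at the points \<open>inv f x\<close> with
  \<open>x\<close> in \<open>A\<close>, hence the image set in the hypothesis.\<close>

lemma asymptotically_commutes_on_inv:
  assumes "asymptotically_commutes_on F (inv f ` A) f" "bij f" "uniformly_continuous_on UNIV (inv f)"
  shows "asymptotically_commutes_on F A (inv f)"
  unfolding asymptotically_commutes_on_def
proof (intro allI impI)
  fix \<epsilon> :: real
  assume "0 < \<epsilon>"
  then obtain \<delta> where "0 < \<delta>" and \<delta>: "\<And>u v. dist u v < \<delta> \<Longrightarrow> dist (inv f u) (inv f v) < \<epsilon>"
    using assms(3) unfolding uniformly_continuous_on_def by (metis UNIV_I)
  then have "\<forall>\<^sub>F n in sequentially. \<forall>z\<in>inv f ` A. dist (omega F n (f z)) (f (omega F n z)) < \<delta>"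
    using assms(1) unfolding asymptotically_commutes_on_def by blast
  then show "\<forall>\<^sub>F n in sequentially. \<forall>x\<in>A. dist (omega F n (inv f x)) (inv f (omega F n x)) < \<epsilon>"
  proof (rule eventually_mono, intro ballI)
    fix n x
    assume "\<forall>z\<in>inv f ` A. dist (omega F n (f z)) (f (omega F n z)) < \<delta>" and "x \<in> A"
    then have "dist (omega F n x) (f (omega F n (inv f x))) < \<delta>"
      using assms(2) by (simp add: bij_is_surj surj_f_inv_f)
    from \<delta>[OF this] show "dist (omega F n (inv f x)) (inv f (omega F n x)) < \<epsilon>"
      using assms(2) by (simp add: bij_is_inj inv_f_f dist_commute)
  qed
qed

text \<open>Two distances are small by commutation at late times, the middle one by uniform
  continuity. Neither \<open>\<delta>\<close> nor \<open>N\<close> depends on the pair, so they can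
  be fixed before the points are known.\<close>

lemma close_times_image:
  assumes "asymptotically_commutes_on F A g" "uniformly_continuous_on UNIV g" "0 < \<epsilon>"
  obtains \<delta> N where "0 < \<delta>"
    "\<And>x y. x \<in> A \<Longrightarrow> y \<in> A \<Longrightarrow> close_times F \<delta> x y \<inter> {N..} \<subseteq> close_times F \<epsilon> (g x) (g y)"
proof -
  have "0 < \<epsilon> / 3" using assms(3) by simp
  then obtain \<delta> where "0 < \<delta>" and \<delta>: "\<And>u v. dist u v < \<delta> \<Longrightarrow> dist (g u) (g v) < \<epsilon> / 3"
    using assms(2) unfolding uniformly_continuous_on_def by (metis UNIV_I)
  obtain N where
    N: "\<And>n x. N \<le> n \<Longrightarrow> x \<in> A \<Longrightarrow> dist (omega F n (g x)) (g (omega F n x)) < \<epsilon> / 3"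
    using assms(1) \<open>0 < \<epsilon> / 3\<close>
    unfolding asymptotically_commutes_on_def eventually_sequentially by blast
  have "dist (omega F n (g x)) (omega F n (g y)) < \<epsilon>"
    if "x \<in> A" "y \<in> A" "N \<le> n" "dist (omega F n x) (omega F n y) < \<delta>" for n x y
  proof (rule dist_triangle_third)
    show "dist (omega F n (g x)) (g (omega F n x)) < \<epsilon> / 3" using N that by blast
    show "dist (g (omega F n x)) (g (omega F n y)) < \<epsilon> / 3" using \<delta> that by blast
    show "dist (g (omega F n y)) (omega F n (g y)) < \<epsilon> / 3"
      using N[OF that(3) that(2)] by (simp add: dist_commute)
  qed
  then show thesis
    using that[of \<delta> N] \<open>0 < \<delta>\<close> unfolding close_times_def by blast
qed

lemma interior_vimage:
  assumes "continuous_on UNIV g" "g x \<in> interior U"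
  shows "x \<in> interior (g -` U)"
proof (rule interiorI)
  show "open (g -` interior U)" using assms(1) by (simp add: open_vimage)
qed (use assms(2) interior_subset in auto)

section \<open>Maps along an orbit\<close>

context nonautonomous_system
begin

lemma uniformly_continuous:
  fixes g :: "'a \<Rightarrow> 'a"
  assumes "continuous_on UNIV g"
  shows "uniformly_continuous_on UNIV g"
  using assms compact_space by (rule compact_uniformly_continuous)

lemma continuous_omega: "continuous_on UNIV (omega F n)"
proof (induction n)
  case (Suc n)
  then show ?case
    using continuous[of "Suc n"]
    by (auto simp del: o_apply intro: continuous_on_compose continuous_on_subset)
qed (simp add: id_def)

lemma homeomorphism_omega:
  assumes "all_homeomorphisms F"
  obtains g where "homeomorphism UNIV UNIV (omega F n) g"
proof (induction n arbitrary: thesis)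
  case 0
  then show ?case using homeomorphism_ident[of UNIV] by (simp add: id_def)
next
  case (Suc n)
  obtain g where "homeomorphism UNIV UNIV (omega F n) g" using Suc.IH .
  moreover obtain h where "homeomorphism UNIV UNIV (F (Suc n)) h"
    using assms unfolding all_homeomorphisms_def by force
  ultimately have "homeomorphism UNIV UNIV (omega F (Suc n)) (g \<circ> h)"
    unfolding omega.simps by (rule homeomorphism_compose)
  then show ?case by (rule Suc.prems)
qed

lemma bij_omega:
  assumes "all_homeomorphisms F"
  shows "bij (omega F n)"
  using homeomorphism_omega[OF assms, of n] by (metis homeomorphism_def bij_def inj_on_inverseI UNIV_I)

lemma continuous_inv_omega:
  assumes "all_homeomorphisms F"
  shows "continuous_on UNIV (inv (omega F n))"
proof -
  obtain g where g: "homeomorphism UNIV UNIV (omega F n) g"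
    using homeomorphism_omega[OF assms] .
  then have "inv (omega F n) = g"
    by (intro inv_equality) (auto simp: homeomorphism_def)
  with g show ?thesis by (simp add: homeomorphism_def)
qed

text \<open>The family \<open>\<A>\<close> lets one argument serve the pointwise and the uniform
  setting. Its closure under images is what the inverse maps require.\<close>

lemma orbit_map_cases:
  assumes "q \<in> pair_orbit F p"
    and "\<And>A r. A \<in> \<A> \<Longrightarrow> 1 \<le> r \<Longrightarrow> asymptotically_commutes_on F A (omega F r)"
    and "\<And>A g. A \<in> \<A> \<Longrightarrow> g ` A \<in> \<A>"
  obtains g where "q = (g (fst p), g (snd p))" "continuous_on UNIV g"
    "\<And>A. A \<in> \<A> \<Longrightarrow> asymptotically_commutes_on F A g"
proof -
  \<comment> \<open>The full orbit contains index \<open>0\<close>, where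
    \<open>omega F 0 = id\<close> commutes exactly.\<close>
  have comm: "asymptotically_commutes_on F A (omega F r)" if "A \<in> \<A>" for A r
    using assms(2)[OF that, of r] by (cases r) (auto simp: asymptotically_commutes_on_def)
  consider (forward) r where "q = (omega F r (fst p), omega F r (snd p))"
    | (backward) r where "all_homeomorphisms F"
        "q = (inv (omega F r) (fst p), inv (omega F r) (snd p))"
    using assms(1) unfolding pair_orbit_def omega_int_def
    by (auto split: if_splits)
  then show thesis
  proof cases
    case forward
    then show thesis using that continuous_omega comm by blast
  next
    case (backward r)
    have "asymptotically_commutes_on F A (inv (omega F r))" if "A \<in> \<A>" for A
      using comm[OF assms(3)[OF that]] bij_omega[OF backward(1)]
        uniformly_continuous[OF continuous_inv_omega[OF backward(1)]]
      by (rule asymptotically_commutes_on_inv)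
    then show thesis using that continuous_inv_omega backward by blast
  qed
qed

text \<open>Finitely many eventual bounds hold simultaneously, and finite sets are closed under
  images.\<close>

lemma orbit_map_pointwise:
  assumes "pointwise_asymptotically_commutative F" "q \<in> pair_orbit F p"
  obtains g where "q = (g (fst p), g (snd p))" "uniformly_continuous_on UNIV g"
    "\<And>A. finite A \<Longrightarrow> asymptotically_commutes_on F A g"
proof -
  have "asymptotically_commutes_on F A (omega F r)" if "A \<in> Collect finite" "1 \<le> r" for A r
    unfolding asymptotically_commutes_on_def
  proof (intro allI impI)
    fix \<epsilon> :: real
    assume "0 < \<epsilon>"
    have "\<forall>\<^sub>F n in sequentially. dist (omega F n (omega F r x)) (omega F r (omega F n x)) < \<epsilon>" for x
    proof -
      have "(\<lambda>n. dist (omega F n (omega F r x)) (omega F r (omega F n x))) \<longlonglongrightarrow> 0"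
        using assms(1) that(2) unfolding pointwise_asymptotically_commutative_def by simp
      then show ?thesis using \<open>0 < \<epsilon>\<close> by (rule order_tendstoD(2))
    qed
    with that(1) show "\<forall>\<^sub>F n in sequentially.
        \<forall>x\<in>A. dist (omega F n (omega F r x)) (omega F r (omega F n x)) < \<epsilon>"
      by (simp add: eventually_ball_finite)
  qed
  from orbit_map_cases[OF assms(2) this] show thesis
    using that uniformly_continuous by (metis finite_imageI mem_Collect_eq)
qed

text \<open>Compactness bounds all distances, so the real supremum is a genuine upper bound.\<close>

lemma dist_le_dist_sup: "dist (f x) (g x) \<le> dist_sup f g" for f g :: "'a \<Rightarrow> 'a"
  unfolding dist_sup_def
proof (rule cSUP_upper)
  obtain b where "\<And>u v :: 'a. dist u v \<le> b"
    using compact_imp_bounded[OF compact_space] unfolding bounded_two_points by auto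
  then show "bdd_above (range (\<lambda>x. dist (f x) (g x)))" by (intro bdd_aboveI2)
qed simp

text \<open>Here the family consists of all sets, since the supremum controls every point at
  once.\<close>

lemma orbit_map_uniform:
  assumes "asymptotically_commutative F" "q \<in> pair_orbit F p"
  obtains g where "q = (g (fst p), g (snd p))" "continuous_on UNIV g"
    "asymptotically_commutes_on F UNIV g"
proof -
  have "asymptotically_commutes_on F A (omega F r)" if "A \<in> UNIV" "1 \<le> r" for A r
    unfolding asymptotically_commutes_on_def
  proof (intro allI impI)
    fix \<epsilon> :: real
    assume "0 < \<epsilon>"
    have "(\<lambda>n. dist_sup (omega F n \<circ> omega F r) (omega F r \<circ> omega F n)) \<longlonglongrightarrow> 0"
      using assms(1) that(2) unfolding asymptotically_commutative_def by blast
    then have "\<forall>\<^sub>F n in sequentially.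
        dist_sup (omega F n \<circ> omega F r) (omega F r \<circ> omega F n) < \<epsilon>"
      using \<open>0 < \<epsilon>\<close> by (rule order_tendstoD(2))
    then show "\<forall>\<^sub>F n in sequentially.
        \<forall>x\<in>A. dist (omega F n (omega F r x)) (omega F r (omega F n x)) < \<epsilon>"
    proof (rule eventually_mono, intro ballI)
      fix n x
      assume "dist_sup (omega F n \<circ> omega F r) (omega F r \<circ> omega F n) < \<epsilon>"
      with dist_le_dist_sup[of "omega F n \<circ> omega F r" x "omega F r \<circ> omega F n"]
      show "dist (omega F n (omega F r x)) (omega F r (omega F n x)) < \<epsilon>" by simp
    qed
  qed
  from orbit_map_cases[OF assms(2) this] show thesis
    using that by (metis UNIV_I)
qed

section \<open>Postponing a single close time\<close>

lemma close_at_later_time: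
  assumes "0 < \<epsilon>"
  obtains \<delta> where "0 < \<delta>"
    "\<And>n x y. n \<le> N \<Longrightarrow> dist (omega F n x) (omega F n y) < \<delta> \<Longrightarrow>
       dist (omega F N x) (omega F N y) < \<epsilon>"
  using assms
proof (induction N arbitrary: \<epsilon> thesis)
  case 0
  then show ?case by (metis le_zero_eq)
next
  case (Suc N)
  have "uniformly_continuous_on UNIV (F (Suc N))"
    by (simp add: uniformly_continuous continuous)
  then obtain \<eta> where "0 < \<eta>"
    and \<eta>: "\<And>u v. dist u v < \<eta> \<Longrightarrow> dist (F (Suc N) u) (F (Suc N) v) < \<epsilon>"
    using \<open>0 < \<epsilon>\<close> unfolding uniformly_continuous_on_def by (metis UNIV_I)
  obtain \<delta> where "0 < \<delta>"
    and \<delta>: "\<And>n x y. n \<le> N \<Longrightarrow> dist (omega F n x) (omega F n y) < \<delta> \<Longrightarrow>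
      dist (omega F N x) (omega F N y) < \<eta>"
    using Suc.IH[OF _ \<open>0 < \<eta>\<close>] by metis
  \<comment> \<open>\<open>\<delta>\<close> serves the times \<open>n \<le> N\<close>, via
    \<open>\<eta>\<close> and one application of \<open>F (Suc N)\<close>; \<open>\<epsilon>\<close>
    serves \<open>n = Suc N\<close>.\<close>
  show ?case
  proof (rule Suc.prems(1)[of "min \<delta> \<epsilon>"])
    fix n x y
    assume "n \<le> Suc N" "dist (omega F n x) (omega F n y) < min \<delta> \<epsilon>"
    then show "dist (omega F (Suc N) x) (omega F (Suc N) y) < \<epsilon>"
      using \<delta>[of n x y] \<eta> by (cases "n = Suc N") auto
  qed (use \<open>0 < \<delta>\<close> \<open>0 < \<epsilon>\<close> in simp)
qed

lemma late_close_times: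
  assumes "0 < \<epsilon>"
  obtains \<delta> where "0 < \<delta>"
    "\<And>x y. close_times F \<delta> x y \<noteq> {} \<Longrightarrow> close_times F \<epsilon> x y \<inter> {N..} \<noteq> {}"
proof -
  obtain \<delta> where "0 < \<delta>"
    and \<delta>: "\<And>n x y. n \<le> N \<Longrightarrow> dist (omega F n x) (omega F n y) < \<delta> \<Longrightarrow>
      dist (omega F N x) (omega F N y) < \<epsilon>"
    using close_at_later_time[OF assms, of N] by metis
  \<comment> \<open>A time before \<open>N\<close> is moved to \<open>N\<close> by
    \<open>\<delta>\<close>; a later one is kept, which is why the minimum includes
    \<open>\<epsilon>\<close>.\<close>
  have "max n N \<in> close_times F \<epsilon> x y \<inter> {N..}" if "n \<in> close_times F (min \<delta> \<epsilon>) x y" for n x y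
    using that \<delta>[of n x y] by (auto simp: close_times_def max_def)
  then show thesis
    using that[of "min \<delta> \<epsilon>"] \<open>0 < \<delta>\<close> assms by (metis all_not_in_conv min_less_iff_conj)
qed

section \<open>Invariance of the four relations\<close>

lemma invariant_proximal_pairs:
  assumes "pointwise_asymptotically_commutative F"
  shows "invariant_pairs F (proximal_pairs F)"
  unfolding invariant_pairs_def
proof (intro ballI subsetI)
  fix p q
  assume p: "p \<in> proximal_pairs F" and "q \<in> pair_orbit F p"
  obtain x y where xy: "p = (x, y)" by fastforce
  \<comment> \<open>Only the two points \<open>x\<close> and \<open>y\<close> are followed, so
    commutation on a finite set suffices.\<close>
  obtain g where q: "q = (g x, g y)" and g: "uniformly_continuous_on UNIV g"
    and comm: "asymptotically_commutes_on F {x, y} g"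
    using orbit_map_pointwise[OF assms \<open>q \<in> pair_orbit F p\<close>] xy
    by (metis finite.emptyI finite_insert fst_conv snd_conv)
  have "close_times F \<epsilon> (g x) (g y) \<inter> {M..} \<noteq> {}" if "0 < \<epsilon>" for \<epsilon> M
  proof -
    obtain \<delta> N where "0 < \<delta>" "close_times F \<delta> x y \<inter> {N..} \<subseteq> close_times F \<epsilon> (g x) (g y)"
      using close_times_image[OF comm g \<open>0 < \<epsilon>\<close>] by (metis insertCI)
    \<comment> \<open>The time must be past \<open>M\<close> for proximality and past
      \<open>N\<close> for the transfer.\<close>
    moreover have "close_times F \<delta> x y \<inter> {max M N..} \<noteq> {}"
      using p \<open>0 < \<delta>\<close> unfolding xy proximal_pairs_iff by blast
    ultimately show ?thesis by fastforce
  qed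
  then show "q \<in> proximal_pairs F" unfolding q proximal_pairs_iff by blast
qed

lemma invariant_syndetically_proximal_pairs:
  assumes "pointwise_asymptotically_commutative F"
  shows "invariant_pairs F (syndetically_proximal_pairs F)"
  unfolding invariant_pairs_def
proof (intro ballI subsetI)
  fix p q
  assume p: "p \<in> syndetically_proximal_pairs F" and "q \<in> pair_orbit F p"
  obtain x y where xy: "p = (x, y)" by fastforce
  obtain g where q: "q = (g x, g y)" and g: "uniformly_continuous_on UNIV g"
    and comm: "asymptotically_commutes_on F {x, y} g"
    using orbit_map_pointwise[OF assms \<open>q \<in> pair_orbit F p\<close>] xy
    by (metis finite.emptyI finite_insert fst_conv snd_conv)
  have "syndetic (close_times F \<epsilon> (g x) (g y))" if "0 < \<epsilon>" for \<epsilon>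
  proof -
    obtain \<delta> N where "0 < \<delta>" "close_times F \<delta> x y \<inter> {N..} \<subseteq> close_times F \<epsilon> (g x) (g y)"
      using close_times_image[OF comm g \<open>0 < \<epsilon>\<close>] by (metis insertCI)
    moreover have "syndetic (close_times F \<delta> x y)"
      using p \<open>0 < \<delta>\<close> unfolding xy syndetically_proximal_pairs_def by blast
    ultimately show ?thesis by (blast intro: syndetic_superset_of_tail)
  qed
  then show "q \<in> syndetically_proximal_pairs F"
    unfolding q syndetically_proximal_pairs_def by blast
qed

text \<open>The nearby points are found only after \<open>\<delta>\<close> and \<open>N\<close> are
  fixed, so commutation must be uniform over the space.\<close>

lemma invariant_regionally_proximal_pairs:
  assumes "asymptotically_commutative F"
  shows "invariant_pairs F (regionally_proximal_pairs F)"
  unfolding invariant_pairs_def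
proof (intro ballI subsetI)
  fix p q
  assume p: "p \<in> regionally_proximal_pairs F" and "q \<in> pair_orbit F p"
  obtain x y where xy: "p = (x, y)" by fastforce
  obtain g where q: "q = (g x, g y)" and g: "continuous_on UNIV g"
    and comm: "asymptotically_commutes_on F UNIV g"
    using orbit_map_uniform[OF assms \<open>q \<in> pair_orbit F p\<close>] xy by (metis fst_conv snd_conv)
  have "\<exists>z1\<in>U. \<exists>z2\<in>V. close_times F \<epsilon> z1 z2 \<noteq> {}"
    if "0 < \<epsilon>" "g x \<in> interior U" "g y \<in> interior V" for \<epsilon> U V
  proof -
    obtain \<delta> N where "0 < \<delta>"
      and \<delta>: "\<And>z1 z2. close_times F \<delta> z1 z2 \<inter> {N..} \<subseteq> close_times F \<epsilon> (g z1) (g z2)"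
      using close_times_image[OF comm uniformly_continuous[OF g] \<open>0 < \<epsilon>\<close>] by (metis UNIV_I)
    \<comment> \<open>\<open>\<delta>'\<close> is chosen after \<open>N\<close>, so that any close
      time it provides can be postponed past \<open>N\<close>.\<close>
    obtain \<delta>' where "0 < \<delta>'"
      and \<delta>': "\<And>z1 z2. close_times F \<delta>' z1 z2 \<noteq> {} \<Longrightarrow> close_times F \<delta> z1 z2 \<inter> {N..} \<noteq> {}"
      using late_close_times[OF \<open>0 < \<delta>\<close>, of N] by metis
    \<comment> \<open>The preimages are neighborhoods of \<open>x\<close> and \<open>y\<close>;
      applying \<open>g\<close> to the points found there yields the witnesses in \<open>U\<close>
      and \<open>V\<close>.\<close>
    have "\<exists>z1\<in>g -` U. \<exists>z2\<in>g -` V. close_times F \<delta>' z1 z2 \<noteq> {}"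
      using p \<open>0 < \<delta>'\<close> interior_vimage[OF g that(2)] interior_vimage[OF g that(3)]
      unfolding xy regionally_proximal_pairs_def by blast
    with \<delta> \<delta>' show ?thesis by (metis subset_empty vimageD)
  qed
  then show "q \<in> regionally_proximal_pairs F"
    unfolding q regionally_proximal_pairs_def by blast
qed

text \<open>A syndetic set survives the loss of the times before \<open>N\<close>, which takes the
  place of the postponement used for regional proximality.\<close>

lemma invariant_regionally_syndetically_proximal_pairs:
  assumes "asymptotically_commutative F"
  shows "invariant_pairs F (regionally_syndetically_proximal_pairs F)"
  unfolding invariant_pairs_def
proof (intro ballI subsetI)
  fix p q
  assume p: "p \<in> regionally_syndetically_proximal_pairs F" and "q \<in> pair_orbit F p"
  obtain x y where xy: "p = (x, y)" by fastforce
  obtain g where q: "q = (g x, g y)" and g: "continuous_on UNIV g"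
    and comm: "asymptotically_commutes_on F UNIV g"
    using orbit_map_uniform[OF assms \<open>q \<in> pair_orbit F p\<close>] xy by (metis fst_conv snd_conv)
  have "\<exists>z1\<in>U. \<exists>z2\<in>V. syndetic (close_times F \<epsilon> z1 z2)"
    if "0 < \<epsilon>" "g x \<in> interior U" "g y \<in> interior V" for \<epsilon> U V
  proof -
    obtain \<delta> N where "0 < \<delta>"
      and \<delta>: "\<And>z1 z2. close_times F \<delta> z1 z2 \<inter> {N..} \<subseteq> close_times F \<epsilon> (g z1) (g z2)"
      using close_times_image[OF comm uniformly_continuous[OF g] \<open>0 < \<epsilon>\<close>] by (metis UNIV_I)
    have "\<exists>z1\<in>g -` U. \<exists>z2\<in>g -` V. syndetic (close_times F \<delta> z1 z2)"
      using p \<open>0 < \<delta>\<close> interior_vimage[OF g that(2)] interior_vimage[OF g that(3)]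
      unfolding xy regionally_syndetically_proximal_pairs_def by blast
    with \<delta> show ?thesis by (meson syndetic_superset_of_tail vimageD)
  qed
  then show "q \<in> regionally_syndetically_proximal_pairs F"
    unfolding q regionally_syndetically_proximal_pairs_def by blast
qed

end

theorem theorem3p1:
  fixes F :: "nat \<Rightarrow> 'a::metric_space \<Rightarrow> 'a"
  assumes "nonautonomous_system F"
  shows "(pointwise_asymptotically_commutative F \<longrightarrow>
            invariant_pairs F (proximal_pairs F) \<and>
            invariant_pairs F (syndetically_proximal_pairs F)) \<and>
         (asymptotically_commutative F \<longrightarrow>
            invariant_pairs F (regionally_proximal_pairs F) \<and>
            invariant_pairs F (regionally_syndetically_proximal_pairs F))"
proof -
  interpret nonautonomous_system F by fact
  show ?thesis
    using invariant_proximal_pairs invariant_syndetically_proximal_pairs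
      invariant_regionally_proximal_pairs invariant_regionally_syndetically_proximal_pairs
    by blast
qed

end
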